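(* For $a>0$, put $F_a(u)=u^2-a^2$. If $$\sqrt{\frac{15}{28}}<a\le\frac{\sqrt3}{2},$$ then both $B_3[F_a]$ and $B_5[F_a]$ have all their zeros on the unit circle $\{z\in\mathbb C:|z|=1\}$, but $C_{F_a,1}^{-}\not\preceq C_{F_a,2}^{-}$. More precisely, for some $t\in\mathbb R$, the polynomial $C_{F_a,2}^{-}+tC_{F_a,1}^{-}$ has a nonreal conjugate pair of zeros.
   Context: For an integer $d\ge0$ and a function $F$, $B_d[F](z)=\sum_{j=0}^{d}\binom dj F\!\left(j-\tfrac d2\right)z^j$. If $F$ is real and even, $C_{F,n}^{-}$ is the unique real polynomial with $$B_{2n+1}[F](z)=z^n(z+1)\,C_{F,n}^{-}(z+z^{-1}).$$ For real polynomials $A,B$, write $A\preceq B$ if every nonzero polynomial of the form $B+tA$, $t\in\mathbb R$, has only real zeros (nonzero constants count as real-rooted), with the conventions $0\preceq 0$, and $0\preceq B$ and $B\preceq 0$ for every nonzero real-rooted polynomial $B$. *)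

theory Defs
  imports "HOL-Computational_Algebra.Computational_Algebra" Complex_Main
begin

abbreviation cpoly :: "real poly \<Rightarrow> complex poly" where
  "cpoly \<equiv> map_poly complex_of_real"

definition Bpoly :: "nat \<Rightarrow> (real \<Rightarrow> 'a::comm_semiring_1) \<Rightarrow> 'a poly" where
  "Bpoly d F = (\<Sum>j=0..d. monom (of_nat (d choose j) * F (real j - real d / 2)) j)"

text \<open>The identity \<open>B\<^bsub>2n+1\<^esub>[F](z) = z\<^sup>n (z + 1) C(z + z\<^sup>-\<^sup>1)\<close> is one of Laurent
  polynomials in \<open>z\<close>; it is stated pointwise, at all nonzero complex \<open>z\<close>.\<close>

definition is_Cminus :: "(real \<Rightarrow> real) \<Rightarrow> nat \<Rightarrow> real poly \<Rightarrow> bool" where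
  "is_Cminus F n C \<longleftrightarrow> (\<forall>z::complex. z \<noteq> 0 \<longrightarrow>
     poly (cpoly (Bpoly (2 * n + 1) F)) z = z ^ n * (z + 1) * poly (cpoly C) (z + inverse z))"

text \<open>The description is meaningful for even \<open>F\<close> only; see \<open>ex1_Cminus\<close> below.\<close>

definition Cminus :: "(real \<Rightarrow> real) \<Rightarrow> nat \<Rightarrow> real poly" where
  "Cminus F n = (THE C. is_Cminus F n C)"

definition real_rooted :: "real poly \<Rightarrow> bool" where
  "real_rooted p \<longleftrightarrow> p \<noteq> 0 \<and> (\<forall>z. poly (cpoly p) z = 0 \<longrightarrow> z \<in> \<real>)"

text \<open>The usual conventions for the zero polynomial are instances of the general clause;
  see \<open>pencil_le_zero\<close> below.\<close>

definition pencil_le :: "real poly \<Rightarrow> real poly \<Rightarrow> bool" (infix "\<preceq>" 50) where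
  "A \<preceq> B \<longleftrightarrow> (\<forall>t::real. B + smult t A \<noteq> 0 \<longrightarrow> real_rooted (B + smult t A))"

definition Fquad :: "real \<Rightarrow> real \<Rightarrow> real" where
  "Fquad a u = u\<^sup>2 - a\<^sup>2"

lemma cpoly_eq_0_iff: "cpoly p = 0 \<longleftrightarrow> p = 0"
  by (simp add: map_poly_eq_0_iff)

lemma cpoly_smult: "cpoly (smult c p) = smult (complex_of_real c) (cpoly p)"
  by (simp add: map_poly_smult)

lemma cpoly_add: "cpoly (p + q) = cpoly p + cpoly q"
  by (rule poly_eqI) (simp add: coeff_map_poly)

lemma cpoly_diff: "cpoly (p - q) = cpoly p - cpoly q"
  by (rule poly_eqI) (simp add: coeff_map_poly)

lemma cpoly_sum: "cpoly (\<Sum>i\<in>A. f i) = (\<Sum>i\<in>A. cpoly (f i))"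
  by (induction A rule: infinite_finite_induct) (simp_all add: cpoly_add)

lemma poly_cpoly_of_real: "poly (cpoly p) (complex_of_real x) = complex_of_real (poly p x)"
  by (induction p) (simp_all add: map_poly_pCons)

lemma real_rooted_smult: "c \<noteq> 0 \<Longrightarrow> real_rooted (smult c p) \<longleftrightarrow> real_rooted p"
  by (simp add: real_rooted_def cpoly_smult)

lemma pencil_le_zero:
  shows "0 \<preceq> 0"
    and "B \<noteq> 0 \<Longrightarrow> 0 \<preceq> B \<longleftrightarrow> real_rooted B"
    and "B \<noteq> 0 \<Longrightarrow> B \<preceq> 0 \<longleftrightarrow> real_rooted B"
  by (auto simp: pencil_le_def real_rooted_smult intro: exI[of _ 1])

fun sympoly :: "nat \<Rightarrow> real poly" where
  "sympoly 0 = 1"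
| "sympoly (Suc 0) = [:-1, 1:]"
| "sympoly (Suc (Suc k)) = pCons 0 (sympoly (Suc k)) - sympoly k"

lemma sympoly:
  assumes "z \<noteq> (0::complex)"
  shows "z ^ k * (z + 1) * poly (cpoly (sympoly k)) (z + inverse z) = 1 + z ^ (2 * k + 1)"
proof (induction k rule: sympoly.induct)
  case 1
  then show ?case by simp
next
  case 2
  show ?case using assms
    by (simp add: map_poly_pCons field_simps)
next
  case (3 k)
  let ?P = "\<lambda>k. poly (cpoly (sympoly k)) (z + inverse z)"
  have "z ^ Suc (Suc k) * (z + 1) * ?P (Suc (Suc k))
      = (z * (z + inverse z)) * (z ^ Suc k * (z + 1) * ?P (Suc k)) - z\<^sup>2 * (z ^ k * (z + 1) * ?P k)"
    by (simp add: cpoly_diff map_poly_pCons algebra_simps power2_eq_square)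
  also have "\<dots> = (z\<^sup>2 + 1) * (1 + z ^ (2 * Suc k + 1)) - z\<^sup>2 * (1 + z ^ (2 * k + 1))"
    unfolding 3 using assms by (simp add: distrib_left power2_eq_square)
  also have "\<dots> = 1 + z ^ (2 * Suc (Suc k) + 1)"
    by (simp add: algebra_simps power2_eq_square)
  finally show ?case .
qed

theorem ex1_Cminus:
  assumes even: "\<And>u. F (- u) = F u"
  shows "\<exists>!C. is_Cminus F n C"
proof (rule ex_ex1I)
  define c where "c j = real ((2 * n + 1) choose j) * F (real j - real (2 * n + 1) / 2)" for j
  have c_sym: "c (2 * n + 1 - j) = c j" if "j \<le> n" for j
  proof -
    have "real (2 * n + 1 - j) - real (2 * n + 1) / 2 = - (real j - real (2 * n + 1) / 2)"
      using that by (simp add: of_nat_diff field_simps)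
    moreover have "(2 * n + 1) choose (2 * n + 1 - j) = (2 * n + 1) choose j"
      using that by (intro binomial_symmetric[symmetric]) simp
    ultimately show ?thesis
      unfolding c_def by (simp only: even)
  qed
  define C where "C = (\<Sum>j\<le>n. smult (c j) (sympoly (n - j)))"
  have "is_Cminus F n C"
    unfolding is_Cminus_def
  proof (intro allI impI)
    fix z :: complex assume z: "z \<noteq> 0"
    let ?g = "\<lambda>j. complex_of_real (c j) * z ^ j"
    have "poly (cpoly (Bpoly (2 * n + 1) F)) z = (\<Sum>j\<in>{0..2 * n + 1}. ?g j)"
      by (simp only: Bpoly_def cpoly_sum poly_sum map_poly_monom of_real_0 poly_monom c_def of_real_mult
          of_real_of_nat_eq)
    also have "{0..2 * n + 1} = {..n} \<union> {n+1..2*n+1}" by auto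
    also have "sum ?g \<dots> = sum ?g {..n} + sum ?g {n+1..2*n+1}"
      by (rule sum.union_disjoint) auto
    also have "sum ?g {n+1..2*n+1} = (\<Sum>j\<le>n. ?g (2 * n + 1 - j))"
      by (rule sum.reindex_bij_witness[of _ "\<lambda>j. 2*n+1-j" "\<lambda>j. 2*n+1-j"]) auto
    also have "sum ?g {..n} + \<dots> = (\<Sum>j\<le>n. ?g j + ?g (2 * n + 1 - j))"
      by (simp add: sum.distrib)
    also have "\<dots> = (\<Sum>j\<le>n. complex_of_real (c j) *
        (z ^ n * (z + 1) * poly (cpoly (sympoly (n - j))) (z + inverse z)))"
    proof (rule sum.cong[OF refl])
      fix j assume "j \<in> {..n}"
      then have j: "j \<le> n" by simp
      have "z ^ n = z ^ j * z ^ (n - j)"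
        using j by (simp flip: power_add)
      then have "z ^ n * (z + 1) * poly (cpoly (sympoly (n - j))) (z + inverse z)
          = z ^ j * (1 + z ^ (2 * (n - j) + 1))"
        using sympoly[OF z, of "n - j"] by (simp add: mult.assoc)
      also have "\<dots> = z ^ j + z ^ (j + (2 * (n - j) + 1))"
        by (simp only: distrib_left power_add mult_1_right)
      also have "j + (2 * (n - j) + 1) = 2 * n + 1 - j"
        using j by simp
      finally show "?g j + ?g (2 * n + 1 - j) = complex_of_real (c j) *
        (z ^ n * (z + 1) * poly (cpoly (sympoly (n - j))) (z + inverse z))"
        by (simp only: c_sym[OF j] distrib_left)
    qed
    also have "\<dots> = z ^ n * (z + 1) * poly (cpoly C) (z + inverse z)"
      by (simp add: C_def cpoly_sum cpoly_smult poly_sum sum_distrib_left mult_ac)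
    finally show "poly (cpoly (Bpoly (2 * n + 1) F)) z
      = z ^ n * (z + 1) * poly (cpoly C) (z + inverse z)" .
  qed
  then show "\<exists>C. is_Cminus F n C" ..
next
  fix C D assume *: "is_Cminus F n C" "is_Cminus F n D"
  let ?w = "\<lambda>x::real. x + inverse x"
  have eq: "poly (C - D) (?w x) = 0" if "x > 1" for x
  proof -
    let ?z = "complex_of_real x"
    have w: "?z + inverse ?z = complex_of_real (?w x)" by simp
    have nz: "?z \<noteq> 0" "?z + 1 \<noteq> 0"
      using that by (auto simp: complex_eq_iff)
    have "poly (cpoly C) (?z + inverse ?z) = poly (cpoly D) (?z + inverse ?z)"
      using * nz unfolding is_Cminus_def by (metis mult_left_cancel mult_eq_0_iff power_not_zero)
    then show ?thesis
      unfolding w poly_cpoly_of_real by simp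
  qed
  have "inj_on ?w {1<..}"
  proof (rule inj_onI)
    fix x y :: real assume xy: "x \<in> {1<..}" "y \<in> {1<..}" "?w x = ?w y"
    then have "(x - y) * (x * y - 1) = 0"
      by (simp add: field_simps)
    moreover have "x * y > 1"
      using xy by (simp add: less_1_mult)
    ultimately show "x = y" by simp
  qed
  then have "infinite (?w ` {1<..})"
    using infinite_Ioi[of "1::real"] by (simp add: finite_image_iff)
  moreover have "?w ` {1<..} \<subseteq> {x. poly (C - D) x = 0}"
    using eq by auto
  ultimately have "C - D = 0"
    using poly_roots_finite finite_subset by blast
  then show "C = D" by simp
qed

end

theory Submission
  imports Defs
begin

text \<open>With \<open>s = a\<^sup>2\<close> and \<open>w = z + 1/z\<close> one finds
  \<open>C\<^sub>1 = (9/4 - s) w - (3/2 + 2s)\<close> and \<open>C\<^sub>2 = (w + 2) ((25/4 - s) w - (15/2 + 2s))\<close>.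
  For \<open>s \<le> 3/4\<close> all their zeros lie in \<open>[-2, 2]\<close>, hence those of \<open>B\<^sub>3\<close> and \<open>B\<^sub>5\<close> lie on the unit
  circle. The zero \<open>w\<^sub>1\<close> of \<open>C\<^sub>1\<close> exceeds both zeros of \<open>C\<^sub>2\<close> exactly when \<open>s > 15/28\<close>; then
  \<open>C\<^sub>2(w\<^sub>1) > 0\<close>, and subtracting the linear Taylor term of \<open>C\<^sub>2\<close> at \<open>w\<^sub>1\<close>, which is a multiple
  of \<open>C\<^sub>1\<close>, leaves \<open>(25/4 - s) (w - w\<^sub>1)\<^sup>2 + C\<^sub>2(w\<^sub>1)\<close>, which has no real zero.\<close>

text \<open>\<open>z\<close> solves the real quadratic \<open>z\<^sup>2 - x * z + 1 = 0\<close>. If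
  \<open>z\<close> is nonreal, the imaginary part gives \<open>x = 2 * Re z\<close> and the real
  part then gives norm 1. If \<open>z\<close> is real, the bound on \<open>x\<close> forces
  \<open>(\<bar>Re z\<bar> - 1)\<^sup>2 \<le> 0\<close>.\<close>

lemma norm_eq_1_if_add_inverse_real:
  fixes z :: complex
  assumes z: "z \<noteq> 0" and x: "z + inverse z = of_real x" and le: "\<bar>x\<bar> \<le> 2"
  shows "norm z = 1"
proof -
  have "z * z + 1 = z * (z + inverse z)"
    using z by (simp add: distrib_left)
  then have eq: "z * z + 1 = of_real x * z"
    using x by (simp add: mult.commute)
  have re: "(Re z)\<^sup>2 - (Im z)\<^sup>2 + 1 = x * Re z"
    using arg_cong[OF eq, of Re] by (simp add: power2_eq_square)
  have im: "2 * Re z * Im z = x * Im z"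
    using arg_cong[OF eq, of Im] by (simp add: mult.commute)
  have "(Re z)\<^sup>2 + (Im z)\<^sup>2 = 1"
  proof (cases "Im z = 0")
    case False
    then have "x = 2 * Re z" using im by simp
    then show ?thesis using re by (simp add: power2_eq_square)
  next
    case True
    have "x * Re z \<le> \<bar>x\<bar> * \<bar>Re z\<bar>"
      by (metis abs_ge_self abs_mult)
    also have "\<dots> \<le> 2 * \<bar>Re z\<bar>"
      using le by (simp add: mult_right_mono)
    finally have "(\<bar>Re z\<bar> - 1)\<^sup>2 \<le> 0"
      using re True by (simp add: power2_diff)
    then have "\<bar>Re z\<bar> = 1" by simp
    then show ?thesis using True by (metis add.right_neutral one_power2 power2_abs zero_power2)
  qed
  then show ?thesis by (simp add: cmod_def)
qed

text \<open>The identity defining \<open>C\<close> says nothing at \<open>z = 0\<close>. The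
  hypothesis on \<open>F\<close> makes the constant coefficient nonzero and so excludes that
  zero.\<close>

lemma Bpoly_roots_norm_1:
  assumes C: "is_Cminus F n C" and F: "F (- (real (2 * n + 1) / 2)) \<noteq> 0"
    and roots: "\<And>w. poly (cpoly C) w = 0 \<Longrightarrow> \<exists>x. w = of_real x \<and> \<bar>x\<bar> \<le> 2"
    and z: "poly (cpoly (Bpoly (2 * n + 1) F)) z = 0"
  shows "norm z = 1"
proof -
  have "coeff (Bpoly (2 * n + 1) F) 0 = F (- (real (2 * n + 1) / 2))"
    by (simp add: Bpoly_def coeff_sum coeff_monom if_distrib cong: if_cong)
  then have "poly (cpoly (Bpoly (2 * n + 1) F)) 0 \<noteq> 0"
    using F by (simp add: poly_0_coeff_0 coeff_map_poly)
  then have nz: "z \<noteq> 0" using z by auto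
  then have "z ^ n * (z + 1) * poly (cpoly C) (z + inverse z) = 0"
    using C z by (simp add: is_Cminus_def)
  then consider "z = -1" | "poly (cpoly C) (z + inverse z) = 0"
    using nz by (auto simp: add_eq_0_iff2)
  then show ?thesis
  proof cases
    case 2
    then show ?thesis using roots norm_eq_1_if_add_inverse_real[OF nz] by blast
  qed simp
qed

lemma Cminus_eqI:
  assumes "\<And>u. F (- u) = F u" and "is_Cminus F n C"
  shows "Cminus F n = C"
  unfolding Cminus_def using ex1_Cminus[of F n] assms by (blast intro: the1_equality)

lemma poly_cpoly_Bpoly:
  "poly (cpoly (Bpoly d F)) z
    = (\<Sum>j=0..d. of_real (real (d choose j) * F (real j - real d / 2)) * z ^ j)"
  by (simp only: Bpoly_def cpoly_sum poly_sum map_poly_monom of_real_0 poly_monom)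

lemma is_Cminus_Fquad_1:
  "is_Cminus (Fquad a) 1 [:- (3/2 + 2 * a\<^sup>2), 9/4 - a\<^sup>2:]"
  unfolding is_Cminus_def
proof (intro allI impI)
  fix z :: complex assume "z \<noteq> 0"
  then show "poly (cpoly (Bpoly (2 * 1 + 1) (Fquad a))) z = z ^ 1 * (z + 1) *
    poly (cpoly [:- (3/2 + 2 * a\<^sup>2), 9/4 - a\<^sup>2:]) (z + inverse z)"
    by (simp add: poly_cpoly_Bpoly Fquad_def map_poly_pCons eval_nat_numeral field_simps)
qed

lemma is_Cminus_Fquad_2:
  "is_Cminus (Fquad a) 2 [:- (15 + 4 * a\<^sup>2), 5 - 4 * a\<^sup>2, 25/4 - a\<^sup>2:]"
  unfolding is_Cminus_def
proof (intro allI impI)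
  fix z :: complex assume "z \<noteq> 0"
  then show "poly (cpoly (Bpoly (2 * 2 + 1) (Fquad a))) z = z ^ 2 * (z + 1) *
    poly (cpoly [:- (15 + 4 * a\<^sup>2), 5 - 4 * a\<^sup>2, 25/4 - a\<^sup>2:]) (z + inverse z)"
    by (simp add: poly_cpoly_Bpoly Fquad_def map_poly_pCons eval_nat_numeral field_simps)
qed

lemma poly_cpoly_cnj: "poly (cpoly p) (cnj z) = cnj (poly (cpoly p) z)"
  by (induction p) (simp_all add: map_poly_pCons)

lemma quadratic_plus_linear_nonreal_root:
  fixes A :: real
  assumes A: "A > 0" and p: "p \<noteq> 0" and pos: "poly [:c, b, A:] (r / p) > 0"
  obtains t z where "z \<notin> \<real>" "poly (cpoly ([:c, b, A:] + smult t [:- r, p:])) z = 0"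
proof -
  define v where "v = r / p"
  define m where "m = poly [:c, b, A:] v"
  \<comment> \<open>Chosen so that \<open>t * (p * w - r)\<close> cancels the slope of the quadratic
    at \<open>v\<close>, the zero of the linear polynomial.\<close>
  define t where "t = - (b + 2 * A * v) / p"
  \<comment> \<open>A zero of the remaining \<open>A * (w - v)\<^sup>2 + m\<close>.\<close>
  define z where "z = Complex v (sqrt (m / A))"
  have m: "m > 0" using pos by (simp add: m_def v_def)
  have t: "t * p = - (b + 2 * A * v)" "t * r = - (b + 2 * A * v) * v"
    using p by (simp_all add: t_def v_def)
  have taylor: "[:c, b, A:] + smult t [:- r, p:] = [:m + A * v\<^sup>2, - (2 * A * v), A:]"
    using t by (simp add: m_def algebra_simps power2_eq_square)
  have "(sqrt (m / A))\<^sup>2 = m / A"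
    using m A by simp
  then have "A * (sqrt (m / A))\<^sup>2 = m"
    using A by simp
  then have "poly (cpoly [:m + A * v\<^sup>2, - (2 * A * v), A:]) z = 0"
    by (simp add: z_def map_poly_pCons complex_eq_iff power2_eq_square algebra_simps)
  moreover have "z \<notin> \<real>"
    using m A by (simp add: z_def complex_is_Real_iff)
  ultimately show ?thesis using that taylor by metis
qed

theorem proposition5p10:
  fixes a :: real
  assumes "a > 0"
    and "sqrt (15 / 28) < a" and "a \<le> sqrt 3 / 2"
  shows "(\<forall>z::complex. poly (cpoly (Bpoly 3 (Fquad a))) z = 0 \<longrightarrow> norm z = 1)
    \<and> (\<forall>z::complex. poly (cpoly (Bpoly 5 (Fquad a))) z = 0 \<longrightarrow> norm z = 1)
    \<and> \<not> Cminus (Fquad a) 1 \<preceq> Cminus (Fquad a) 2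
    \<and> (\<exists>t::real. \<exists>z::complex. z \<notin> \<real>
          \<and> poly (cpoly (Cminus (Fquad a) 2 + smult t (Cminus (Fquad a) 1))) z = 0
          \<and> poly (cpoly (Cminus (Fquad a) 2 + smult t (Cminus (Fquad a) 1))) (cnj z) = 0)"
proof -
  define s where "s = a\<^sup>2"
  have "a\<^sup>2 \<le> (sqrt 3 / 2)\<^sup>2" using assms by (intro power_mono) auto
  then have s_le: "s \<le> 3/4" by (simp add: s_def power_divide)
  have "(sqrt (15/28))\<^sup>2 < a\<^sup>2" using assms by (intro power_strict_mono) auto
  then have s_gt: "s > 15/28" by (simp add: s_def)
  let ?C1 = "[:- (3/2 + 2 * s), 9/4 - s:]"
  let ?C2 = "[:- (15 + 4 * s), 5 - 4 * s, 25/4 - s:]"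
  have is1: "is_Cminus (Fquad a) 1 ?C1" and is2: "is_Cminus (Fquad a) 2 ?C2"
    unfolding s_def by (rule is_Cminus_Fquad_1 is_Cminus_Fquad_2)+
  have C1: "Cminus (Fquad a) 1 = ?C1" and C2: "Cminus (Fquad a) 2 = ?C2"
    by (rule Cminus_eqI[OF _ is1] Cminus_eqI[OF _ is2], simp add: Fquad_def)+
  have roots1: "\<exists>x. w = of_real x \<and> \<bar>x\<bar> \<le> 2" if "poly (cpoly ?C1) w = 0" for w
  proof (intro exI conjI)
    let ?p = "complex_of_real (9/4 - s)"
    have "?p \<noteq> 0" using s_le by (simp only: of_real_eq_0_iff)
    moreover have "w * ?p = of_real (3/2 + 2 * s)"
      using that by (simp add: map_poly_pCons algebra_simps)
    ultimately show "w = of_real ((3/2 + 2 * s) / (9/4 - s))"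
      unfolding of_real_divide by (rule eq_divide_imp)
    \<comment> \<open>After clearing the positive denominator this is exactly
      \<open>s \<le> 3/4\<close>, the upper bound on \<open>a\<close>.\<close>
    show "\<bar>(3/2 + 2 * s) / (9/4 - s)\<bar> \<le> 2"
      using s_le s_gt by (simp add: field_simps)
  qed
  have roots2: "\<exists>x. w = of_real x \<and> \<bar>x\<bar> \<le> 2" if root: "poly (cpoly ?C2) w = 0" for w
  proof -
    let ?p = "complex_of_real (25/4 - s)"
    have "(w + 2) * (w * ?p - of_real (15/2 + 2 * s)) = poly (cpoly ?C2) w"
      by (simp add: map_poly_pCons field_simps)
    then consider "w + 2 = 0" | "w * ?p = of_real (15/2 + 2 * s)"
      unfolding root mult_eq_0_iff right_minus_eq by blast
    then show ?thesis
    proof cases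
      case 1
      then have "w = of_real (-2)" by (simp add: add_eq_0_iff2)
      then show ?thesis by (intro exI[of _ "-2"]) simp
    next
      case 2
      have "?p \<noteq> 0" using s_le by (simp only: of_real_eq_0_iff)
      with 2 have "w = of_real ((15/2 + 2 * s) / (25/4 - s))"
        unfolding of_real_divide by (intro eq_divide_imp)
      \<comment> \<open>Here \<open>s \<le> 5/4\<close> would already suffice.\<close>
      moreover have "\<bar>(15/2 + 2 * s) / (25/4 - s)\<bar> \<le> 2"
        using s_le s_gt by (simp add: field_simps)
      ultimately show ?thesis by blast
    qed
  qed
  \<comment> \<open>The constant coefficients of the two polynomials are \<open>9/4 - s\<close> and
    \<open>25/4 - s\<close>, both positive.\<close>
  have B3: "norm z = 1" if "poly (cpoly (Bpoly 3 (Fquad a))) z = 0" for z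
    using that s_le by (intro Bpoly_roots_norm_1[OF is1 _ roots1])
      (auto simp: Fquad_def s_def power_divide)
  have B5: "norm z = 1" if "poly (cpoly (Bpoly 5 (Fquad a))) z = 0" for z
    using that s_le by (intro Bpoly_roots_norm_1[OF is2 _ roots2])
      (auto simp: Fquad_def s_def power_divide)
  let ?v = "(3/2 + 2 * s) / (9/4 - s)"
  have "poly ?C2 ?v = (?v + 2) * (?v * (25/4 - s) - (15/2 + 2 * s))"
    by (simp only: poly_pCons poly_0) algebra
  moreover have "?v + 2 > 0" using s_le s_gt by (simp add: add_pos_pos)
  \<comment> \<open>The \<open>s\<^sup>2\<close> terms cancel, and positivity of the numerator is
    exactly \<open>s > 15/28\<close>, the lower bound on \<open>a\<close>.\<close>
  moreover have "?v * (25/4 - s) - (15/2 + 2 * s) = (14 * s - 15/2) / (9/4 - s)"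
    using s_le by (simp add: field_simps)
  moreover have "(14 * s - 15/2) / (9/4 - s) > 0"
    using s_le s_gt by simp
  ultimately have "poly ?C2 ?v > 0"
    by (simp only: mult_pos_pos)
  moreover have "25/4 - s > 0" "9/4 - s \<noteq> 0" using s_le by auto
  ultimately obtain t z where z: "z \<notin> \<real>" "poly (cpoly (?C2 + smult t ?C1)) z = 0"
    using quadratic_plus_linear_nonreal_root by blast
  \<comment> \<open>\<open>\<preceq>\<close> constrains only nonzero members of the pencil; here the
    leading coefficient \<open>25/4 - s\<close> is nonzero.\<close>
  have "?C2 + smult t ?C1 \<noteq> 0"
    using s_le by auto
  then have "\<not> ?C1 \<preceq> ?C2"
    using z unfolding pencil_le_def real_rooted_def by blast
  moreover have "poly (cpoly (?C2 + smult t ?C1)) (cnj z) = 0"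
    by (simp only: poly_cpoly_cnj z(2) complex_cnj_zero)
  ultimately show ?thesis
    unfolding C1 C2 using B3 B5 z by blast
qed

end
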